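(* Let $G$ be a finite simple graph of order $n$ with at least one edge. Then $es_{\chi'}(G)=\lfloor \frac{n}{2} \rfloor$ if and only if one of the following holds: (1) $G$ has odd order and is isomorphic to the complete graph $K_n$; (2) $G$ is a Class $1$ regular graph of even order; (3) $G$ is a Class $1$ graph of odd order with $|E(G)|=\frac{(n-1)\Delta(G)}{2}$.
   Context: All graphs are finite, simple and have at least one edge. $\chi'(G)$ is the chromatic index (minimum number of colors in a proper edge coloring) and $\Delta(G)$ the maximum degree of $G$. $G$ is of Class 1 if $\chi'(G)=\Delta(G)$. The chromatic edge stability index $es_{\chi'}(G)$ is the minimum cardinality of a set of edges $F\subseteq E(G)$ such that $\chi'(G\setminus F)<\chi'(G)$, where $G\setminus F$ is $G$ with the edges of $F$ deleted (all vertices are kept; an edgeless graph has chromatic index $0$). A graph is regular if all its vertices have the same degree. *)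

theory Defs
  imports Complex_Main
begin

record 'a ugraph =
  verts :: "'a set"
  edges :: "'a set set"

definition simple_graph :: "'a ugraph \<Rightarrow> bool" where
  "simple_graph G \<longleftrightarrow> finite (verts G) \<and> (\<forall>e \<in> edges G. e \<subseteq> verts G \<and> card e = 2)"

abbreviation order :: "'a ugraph \<Rightarrow> nat" where
  "order G \<equiv> card (verts G)"

definition degree :: "'a ugraph \<Rightarrow> 'a \<Rightarrow> nat" where
  "degree G v = card {e \<in> edges G. v \<in> e}"

text \<open>Meaningful only when the vertex set is finite and nonempty.\<close>

definition max_degree :: "'a ugraph \<Rightarrow> nat" where
  "max_degree G = Max (degree G ` verts G)"

definition regular :: "'a ugraph \<Rightarrow> bool" where
  "regular G \<longleftrightarrow> (\<exists>d. \<forall>v \<in> verts G. degree G v = d)"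

definition proper_edge_coloring :: "'a ugraph \<Rightarrow> ('a set \<Rightarrow> nat) \<Rightarrow> bool" where
  "proper_edge_coloring G c \<longleftrightarrow>
     (\<forall>e \<in> edges G. \<forall>f \<in> edges G. e \<noteq> f \<and> e \<inter> f \<noteq> {} \<longrightarrow> c e \<noteq> c f)"

definition edge_colorable :: "'a ugraph \<Rightarrow> nat \<Rightarrow> bool" where
  "edge_colorable G k \<longleftrightarrow> (\<exists>c. proper_edge_coloring G c \<and> c ` edges G \<subseteq> {..<k})"

definition chromatic_index :: "'a ugraph \<Rightarrow> nat" where
  "chromatic_index G = (LEAST k. edge_colorable G k)"

definition class_1 :: "'a ugraph \<Rightarrow> bool" where
  "class_1 G \<longleftrightarrow> chromatic_index G = max_degree G"

definition delete_edges :: "'a ugraph \<Rightarrow> 'a set set \<Rightarrow> 'a ugraph" where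
  "delete_edges G F = \<lparr>verts = verts G, edges = edges G - F\<rparr>"

text \<open>Well defined as soon as \<open>G\<close> is a finite graph with an edge: then \<open>F = edges G\<close> qualifies.\<close>

definition chromatic_edge_stability_index :: "'a ugraph \<Rightarrow> nat" where
  "chromatic_edge_stability_index G =
     (LEAST m. \<exists>F \<subseteq> edges G. card F = m \<and>
        chromatic_index (delete_edges G F) < chromatic_index G)"

definition complete_graph :: "nat \<Rightarrow> nat ugraph" where
  "complete_graph n = \<lparr>verts = {..<n}, edges = {e. e \<subseteq> {..<n} \<and> card e = 2}\<rparr>"

definition isomorphic :: "'a ugraph \<Rightarrow> 'b ugraph \<Rightarrow> bool" where
  "isomorphic G H \<longleftrightarrow>
     (\<exists>f. bij_betw f (verts G) (verts H) \<and>
       (\<forall>u \<in> verts G. \<forall>v \<in> verts G. {u, v} \<in> edges G \<longleftrightarrow> {f u, f v} \<in> edges H))"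

end

theory Submission
  imports Defs
begin

text \<open>
  Everything rests on one counting criterion. Write \<open>k\<close> for the chromatic index and \<open>n\<close> for the
  order. Colour classes are matchings, so they have at most \<open>n div 2\<close> edges, and deleting a
  whole class of an optimal colouring saves a colour. Hence the stability index never exceeds
  \<open>n div 2\<close>, and if it equals \<open>n div 2\<close> then every class is that large, so that there are exactly
  \<open>k * (n div 2)\<close> edges. Conversely, a graph with that many edges keeps more than
  \<open>(k - 1) * (n div 2)\<close> edges when fewer than \<open>n div 2\<close> are deleted, which is too many for
  \<open>k - 1\<close> matchings. This is \<open>stability_index_eq_half_order_iff\<close>.

  It remains to find the graphs with \<open>k * (n div 2)\<close> edges, using the handshake identity and
  \<open>k \<ge> \<Delta>\<close>. If \<open>n\<close> is even, the degrees are at most \<open>\<Delta> \<le> k\<close> and average to \<open>k\<close>, so all of them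
  equal \<open>\<Delta> = k\<close>. If \<open>n\<close> is odd and \<open>k = \<Delta>\<close>, the criterion is literally the third alternative.
  If \<open>n\<close> is odd and \<open>k > \<Delta>\<close>, then \<open>(\<Delta> + 1) * (n - 1) \<le> 2 * |E| \<le> n * \<Delta>\<close> forces \<open>\<Delta> = n - 1\<close>
  and hence \<open>k \<ge> n\<close>, so that the count reaches the number of all pairs of vertices and the graph
  is complete. Finally, a complete graph of odd order satisfies the criterion because colouring
  the edge \<open>{i, j}\<close> with \<open>i + j\<close> modulo \<open>n\<close> shows \<open>k \<le> n\<close>, and counting edges shows \<open>k \<ge> n\<close>.
\<close>

section \<open>Degrees and edge counts\<close>

lemma finite_edges:
  assumes "simple_graph G"
  shows "finite (edges G)"
proof (rule finite_subset)
  show "edges G \<subseteq> Pow (verts G)" using assms by (auto simp: simple_graph_def)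
qed (use assms in \<open>simp add: simple_graph_def\<close>)

lemma sum_degree_eq_twice_card_edges:
  assumes "simple_graph G"
  shows "(\<Sum>v\<in>verts G. degree G v) = 2 * card (edges G)"
proof -
  have fV: "finite (verts G)" using assms by (simp add: simple_graph_def)
  have "(\<Sum>v\<in>verts G. degree G v) = (\<Sum>v\<in>verts G. \<Sum>e\<in>edges G. if v \<in> e then 1 else 0)"
    by (simp add: degree_def sum.If_cases finite_edges[OF assms] Int_def)
  also have "\<dots> = (\<Sum>e\<in>edges G. \<Sum>v\<in>verts G. if v \<in> e then 1 else 0)"
    by (rule sum.swap)
  also have "\<dots> = (\<Sum>e\<in>edges G. 2)"
  proof (rule sum.cong[OF refl])
    fix e assume "e \<in> edges G"
    then have "verts G \<inter> e = e" "card e = 2" using assms by (auto simp: simple_graph_def)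
    then show "(\<Sum>v\<in>verts G. if v \<in> e then 1 else 0) = (2::nat)"
      by (simp add: sum.If_cases fV)
  qed
  finally show ?thesis by simp
qed

lemma degree_le_max_degree:
  assumes "simple_graph G" and "v \<in> verts G"
  shows "degree G v \<le> max_degree G"
  using assms by (simp add: max_degree_def simple_graph_def)

lemma max_degree_attained:
  assumes "simple_graph G" and "verts G \<noteq> {}"
  obtains v where "v \<in> verts G" and "degree G v = max_degree G"
proof -
  have "max_degree G \<in> degree G ` verts G"
    unfolding max_degree_def using assms by (intro Max_in) (auto simp: simple_graph_def)
  then show ?thesis using that by (metis imageE)
qed

lemma twice_card_edges_le:
  assumes "simple_graph G"
  shows "2 * card (edges G) \<le> order G * max_degree G"
  using sum_bounded_above[of "verts G" "degree G" "max_degree G"] degree_le_max_degree[OF assms]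
  by (simp add: sum_degree_eq_twice_card_edges[OF assms])

lemma regular_card_edges:
  assumes "simple_graph G" and "regular G" and "verts G \<noteq> {}"
  shows "2 * card (edges G) = order G * max_degree G"
proof -
  obtain v where "v \<in> verts G" "degree G v = max_degree G"
    using max_degree_attained assms by blast
  then have "\<forall>u\<in>verts G. degree G u = max_degree G"
    using assms(2) by (metis regular_def)
  then show ?thesis
    by (simp flip: sum_degree_eq_twice_card_edges[OF assms(1)])
qed

lemma regular_if_card_edges:
  assumes "simple_graph G" and "2 * card (edges G) = order G * max_degree G"
  shows "regular G"
proof -
  have fV: "finite (verts G)" using assms by (simp add: simple_graph_def)
  have "(\<Sum>v\<in>verts G. degree G v) = (\<Sum>v\<in>verts G. max_degree G)"
    using assms by (simp add: sum_degree_eq_twice_card_edges)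
  then have "\<forall>v\<in>verts G. degree G v = max_degree G"
    using degree_le_max_degree[OF assms(1)] fV
    by (metis sum_strict_mono_ex1 le_neq_implies_less less_irrefl)
  then show ?thesis by (auto simp: regular_def)
qed

lemma order_ge_2:
  assumes "simple_graph G" and "edges G \<noteq> {}"
  shows "order G \<ge> 2"
proof -
  obtain e where "e \<in> edges G" using assms(2) by blast
  then show ?thesis using assms(1) card_mono[of "verts G" e] by (auto simp: simple_graph_def)
qed

section \<open>Colour classes and the chromatic index\<close>

lemma card_pairwise_disjoint_pairs_le:
  assumes "finite V" and "\<And>e. e \<in> M \<Longrightarrow> e \<subseteq> V \<and> card e = 2" and "pairwise disjnt M"
  shows "card M \<le> card V div 2"
proof -
  have "card (\<Union>M) = (\<Sum>e\<in>M. card e)"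
    using assms by (intro card_Union_disjoint) (auto intro: finite_subset)
  also have "\<dots> = 2 * card M" using assms(2) by simp
  finally have "2 * card M \<le> card V"
    using card_mono[of V "\<Union>M"] assms by auto
  then show ?thesis by simp
qed

lemma card_colour_class_le:
  assumes "simple_graph G" and "proper_edge_coloring G c"
  shows "card {e \<in> edges G. c e = i} \<le> order G div 2"
proof (rule card_pairwise_disjoint_pairs_le)
  show "pairwise disjnt {e \<in> edges G. c e = i}"
    using assms(2) by (auto simp: proper_edge_coloring_def pairwise_def disjnt_def)
qed (use assms(1) in \<open>auto simp: simple_graph_def\<close>)

lemma card_edges_eq_sum_colour_classes:
  fixes c :: "'a set \<Rightarrow> nat"
  assumes "finite (edges G)" and "c ` edges G \<subseteq> {..<k}"
  shows "card (edges G) = (\<Sum>i<k. card {e \<in> edges G. c e = i})"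
  using sum.group[OF assms(1) finite_lessThan assms(2), of "\<lambda>_. 1::nat"] by simp

lemma card_edges_le_if_edge_colorable:
  assumes "simple_graph G" and "edge_colorable G k"
  shows "card (edges G) \<le> k * (order G div 2)"
proof -
  obtain c where c: "proper_edge_coloring G c" "c ` edges G \<subseteq> {..<k}"
    using assms by (auto simp: edge_colorable_def)
  have "(\<Sum>i<k. card {e \<in> edges G. c e = i}) \<le> (\<Sum>i<k. order G div 2)"
    by (intro sum_mono card_colour_class_le assms c)
  then show ?thesis
    using card_edges_eq_sum_colour_classes[OF finite_edges[OF assms(1)] c(2)] by simp
qed

lemma degree_le_if_edge_colorable:
  assumes "edge_colorable G k"
  shows "degree G v \<le> k"
proof -
  obtain c where c: "proper_edge_coloring G c" "c ` edges G \<subseteq> {..<k}"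
    using assms by (auto simp: edge_colorable_def)
  have "inj_on c {e \<in> edges G. v \<in> e}"
    using c(1) by (auto simp: proper_edge_coloring_def inj_on_def)
  then have "degree G v \<le> card {..<k}"
    unfolding degree_def using c(2) by (intro card_inj_on_le) auto
  then show ?thesis by simp
qed

lemma edge_colorable_chromatic_index:
  assumes "finite (edges G)"
  shows "edge_colorable G (chromatic_index G)"
proof -
  obtain c where "bij_betw c (edges G) {..<card (edges G)}"
    using ex_bij_betw_finite_nat[OF assms] by (auto simp: atLeast0LessThan)
  then have "edge_colorable G (card (edges G))"
    unfolding edge_colorable_def proper_edge_coloring_def
    by (intro exI[of _ c]) (auto simp: bij_betw_def inj_on_def)
  then show ?thesis unfolding chromatic_index_def by (rule LeastI)
qed

lemma chromatic_index_le: "edge_colorable G k \<Longrightarrow> chromatic_index G \<le> k"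
  unfolding chromatic_index_def by (rule Least_le)

lemma chromatic_index_pos:
  assumes "finite (edges G)" and "edges G \<noteq> {}"
  shows "chromatic_index G > 0"
  using edge_colorable_chromatic_index[OF assms(1)] assms(2)
  by (cases "chromatic_index G") (auto simp: edge_colorable_def)

lemma max_degree_le_chromatic_index:
  assumes "simple_graph G" and "verts G \<noteq> {}"
  shows "max_degree G \<le> chromatic_index G"
  using max_degree_attained[OF assms] degree_le_if_edge_colorable
    edge_colorable_chromatic_index finite_edges assms(1) by metis

section \<open>The stability index by counting edges\<close>

lemma edges_delete_edges [simp]: "edges (delete_edges G F) = edges G - F"
  and verts_delete_edges [simp]: "verts (delete_edges G F) = verts G"
  by (simp_all add: delete_edges_def)

lemma simple_graph_delete_edges: "simple_graph G \<Longrightarrow> simple_graph (delete_edges G F)"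
  by (simp add: simple_graph_def)

text \<open>Once colour \<open>i\<close> is free, the edges of the last colour can take it over.\<close>

lemma edge_colorable_delete_colour_class:
  assumes c: "proper_edge_coloring G c" "c ` edges G \<subseteq> {..<k}" and "i < k"
  shows "edge_colorable (delete_edges G {e \<in> edges G. c e = i}) (k - 1)"
proof -
  define d where "d e = (if c e = k - 1 then i else c e)" for e
  have "proper_edge_coloring (delete_edges G {e \<in> edges G. c e = i}) d"
    unfolding proper_edge_coloring_def
  proof (intro ballI impI)
    fix e f
    assume ef: "e \<in> edges (delete_edges G {e \<in> edges G. c e = i})"
      "f \<in> edges (delete_edges G {e \<in> edges G. c e = i})" "e \<noteq> f \<and> e \<inter> f \<noteq> {}"
    then have "c e \<noteq> c f" using c(1) unfolding proper_edge_coloring_def by simp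
    then show "d e \<noteq> d f" using ef by (auto simp: d_def)
  qed
  moreover have "d e < k - 1" if "e \<in> edges G" "c e \<noteq> i" for e
  proof -
    have "c e < k" using c(2) that by auto
    then show ?thesis using that \<open>i < k\<close> by (auto simp: d_def)
  qed
  ultimately show ?thesis unfolding edge_colorable_def by (intro exI[of _ d]) auto
qed

lemma stability_index_le:
  assumes "F \<subseteq> edges G" and "chromatic_index (delete_edges G F) < chromatic_index G"
  shows "chromatic_edge_stability_index G \<le> card F"
  unfolding chromatic_edge_stability_index_def by (rule Least_le) (use assms in blast)

lemma stability_index_le_card_colour_class:
  assumes "c ` edges G \<subseteq> {..<chromatic_index G}" and "proper_edge_coloring G c"
    and "i < chromatic_index G"
  shows "chromatic_edge_stability_index G \<le> card {e \<in> edges G. c e = i}"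
proof (rule stability_index_le)
  show "chromatic_index (delete_edges G {e \<in> edges G. c e = i}) < chromatic_index G"
    using chromatic_index_le[OF edge_colorable_delete_colour_class[OF assms(2,1,3)]] assms(3)
    by linarith
qed auto

lemma stability_index_attained:
  assumes "finite (edges G)" and "edges G \<noteq> {}"
  obtains F where "F \<subseteq> edges G" and "card F = chromatic_edge_stability_index G"
    and "chromatic_index (delete_edges G F) < chromatic_index G"
proof -
  have "edge_colorable (delete_edges G (edges G)) 0"
    by (simp add: edge_colorable_def proper_edge_coloring_def)
  then have "chromatic_index (delete_edges G (edges G)) < chromatic_index G"
    using chromatic_index_le chromatic_index_pos[OF assms] by fastforce
  then have "\<exists>m. \<exists>F\<subseteq>edges G. card F = m \<and>
      chromatic_index (delete_edges G F) < chromatic_index G" by blast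
  from LeastI_ex[OF this] that show ?thesis
    unfolding chromatic_edge_stability_index_def by blast
qed

theorem stability_index_eq_half_order_iff:
  assumes G: "simple_graph G" "edges G \<noteq> {}"
  shows "chromatic_edge_stability_index G = order G div 2
    \<longleftrightarrow> card (edges G) = chromatic_index G * (order G div 2)"
    (is "?es = ?m \<longleftrightarrow> card (edges G) = ?k * ?m")
proof -
  note fin = finite_edges[OF G(1)]
  have k: "?k > 0" by (rule chromatic_index_pos[OF fin G(2)])
  obtain c where c: "proper_edge_coloring G c" "c ` edges G \<subseteq> {..<?k}"
    using edge_colorable_chromatic_index[OF fin] by (auto simp: edge_colorable_def)
  note class_ge = stability_index_le_card_colour_class[OF c(2,1)]
    and class_le = card_colour_class_le[OF G(1) c(1)]
  have es_le: "?es \<le> ?m" using class_ge[OF k] class_le le_trans by blast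
  show ?thesis
  proof
    assume "?es = ?m"
    then have "card {e \<in> edges G. c e = i} = ?m" if "i < ?k" for i
      using class_ge[OF that] class_le[of i] by simp
    then show "card (edges G) = ?k * ?m"
      using card_edges_eq_sum_colour_classes[OF fin c(2)] by simp
  next
    assume count: "card (edges G) = ?k * ?m"
    obtain F where F: "F \<subseteq> edges G" "card F = ?es"
      "chromatic_index (delete_edges G F) < ?k"
      using stability_index_attained[OF fin G(2)] .
    let ?H = "delete_edges G F"
    \<comment> \<open>The edges outside \<open>F\<close> split into at most \<open>?k - 1\<close> matchings, so \<open>F\<close> makes up for a full one.\<close>
    have "card (edges G - F) \<le> chromatic_index ?H * ?m"
      using card_edges_le_if_edge_colorable[OF simple_graph_delete_edges[OF G(1)]
          edge_colorable_chromatic_index, of F] fin by simp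
    also have "\<dots> \<le> (?k - 1) * ?m" using F(3) by (intro mult_right_mono) auto
    finally have "?k * ?m - ?es \<le> (?k - 1) * ?m"
      using F(1,2) fin count by (simp add: card_Diff_subset finite_subset)
    then have "?m \<le> ?es" using k by (cases ?k) auto
    then show "?es = ?m" using es_le by simp
  qed
qed

section \<open>Complete graphs\<close>

lemma isomorphic_complete_graph_iff:
  assumes "simple_graph G"
  shows "isomorphic G (complete_graph (order G))
    \<longleftrightarrow> edges G = {e. e \<subseteq> verts G \<and> card e = 2}"
proof
  assume "isomorphic G (complete_graph (order G))"
  then obtain f where f: "bij_betw f (verts G) {..<order G}"
    "\<And>u v. u \<in> verts G \<Longrightarrow> v \<in> verts G \<Longrightarrow>
       {u, v} \<in> edges G \<longleftrightarrow> {f u, f v} \<subseteq> {..<order G} \<and> card {f u, f v} = 2"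
    unfolding isomorphic_def complete_graph_def by auto
  have "e \<in> edges G" if e: "e \<subseteq> verts G" "card e = 2" for e
  proof -
    obtain u v where uv: "e = {u, v}" "u \<noteq> v" using e(2) by (auto simp: card_2_iff)
    then have "f u \<noteq> f v" "f u < order G" "f v < order G"
      using f(1) e(1) by (auto simp: bij_betw_def inj_on_def)
    then show ?thesis using f(2)[of u v] uv e(1) by simp
  qed
  then show "edges G = {e. e \<subseteq> verts G \<and> card e = 2}"
    using assms by (auto simp: simple_graph_def)
next
  assume E: "edges G = {e. e \<subseteq> verts G \<and> card e = 2}"
  obtain f where f: "bij_betw f (verts G) {..<order G}"
    using ex_bij_betw_finite_nat[of "verts G"] assms
    by (auto simp: simple_graph_def atLeast0LessThan)
  have "{u, v} \<in> edges G \<longleftrightarrow> {f u, f v} \<in> edges (complete_graph (order G))"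
    if "u \<in> verts G" "v \<in> verts G" for u v
  proof -
    have "f u < order G" "f v < order G" "f u = f v \<longleftrightarrow> u = v"
      using f that by (auto simp: bij_betw_def inj_on_def)
    then show ?thesis using that by (simp add: E complete_graph_def card_insert_if)
  qed
  then show "isomorphic G (complete_graph (order G))"
    using f by (auto simp: isomorphic_def complete_graph_def)
qed

text \<open>
  Number the vertices by \<open>0, \<dots>, n - 1\<close> and give each edge the sum of its ends modulo \<open>n\<close>:
  at a fixed end, the colour determines the other one.
\<close>

lemma edge_colorable_order:
  assumes "simple_graph G"
  shows "edge_colorable G (order G)"
proof -
  obtain f where f: "bij_betw f (verts G) {..<order G}"
    using ex_bij_betw_finite_nat[of "verts G"] assms
    by (auto simp: simple_graph_def atLeast0LessThan)
  define c where "c e = (\<Sum>v\<in>e. f v) mod order G" for e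
  have pair: "\<exists>w. e = {u, w} \<and> u \<noteq> w \<and> u \<in> verts G \<and> w \<in> verts G"
    if "e \<in> edges G" "u \<in> e" for e u
    using that assms by (fastforce simp: simple_graph_def card_2_iff)
  have "e = e'" if e: "e \<in> edges G" "e' \<in> edges G" "u \<in> e" "u \<in> e'" and eq: "c e = c e'" for e e' u
  proof -
    obtain w w' where w: "e = {u, w}" "u \<noteq> w" "w \<in> verts G"
      and w': "e' = {u, w'}" "u \<noteq> w'" "w' \<in> verts G"
      using pair e by metis
    have lt: "f w < order G" "f w' < order G" using f w(3) w'(3) by (auto simp: bij_betw_def)
    have "(f u + f w) mod order G = (f u + f w') mod order G"
      using eq w w' by (simp add: c_def)
    then have "int (f u + f w) mod int (order G) = int (f u + f w') mod int (order G)"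
      by (simp only: of_nat_mod [symmetric])
    then have "int (order G) dvd int (f w) - int (f w')"
      by (simp add: mod_eq_dvd_iff)
    then have "f w = f w'"
      using lt dvd_imp_le_int[of "int (f w) - int (f w')" "int (order G)"] by linarith
    then show ?thesis using f w w' by (auto simp: bij_betw_def inj_on_def)
  qed
  then have "proper_edge_coloring G c" by (auto simp: proper_edge_coloring_def)
  moreover have "c e < order G" if "e \<in> edges G" for e
  proof -
    have "order G > 0" using order_ge_2[OF assms] that by fastforce
    then show ?thesis by (simp add: c_def)
  qed
  ultimately show ?thesis by (auto simp: edge_colorable_def)
qed

lemma twice_card_pairs:
  assumes "finite V"
  shows "2 * card {e. e \<subseteq> V \<and> card e = 2} = card V * (card V - 1)"
proof -
  have "even (card V * (card V - 1))" by (cases "card V") auto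
  then show ?thesis by (simp add: n_subsets[OF assms] choose_two)
qed

section \<open>The extremal graphs\<close>

text \<open>
  For even order \<open>n\<close> the count says that the degrees average to the chromatic index, which
  is at least the largest of them.
\<close>

lemma card_edges_eq_iff_even:
  assumes G: "simple_graph G" "verts G \<noteq> {}" and "even (order G)"
  shows "card (edges G) = chromatic_index G * (order G div 2) \<longleftrightarrow> class_1 G \<and> regular G"
proof -
  obtain m where m: "order G = 2 * m" using assms(3) by blast
  have "m > 0" using G m by (auto simp: simple_graph_def card_gt_0_iff)
  show ?thesis
  proof
    assume count: "card (edges G) = chromatic_index G * (order G div 2)"
    then have "m * chromatic_index G \<le> m * max_degree G"
      using twice_card_edges_le[OF G(1)] m by (simp add: ac_simps)
    then have eq: "chromatic_index G = max_degree G"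
      using \<open>m > 0\<close> max_degree_le_chromatic_index[OF G] by simp
    then show "class_1 G \<and> regular G"
      using regular_if_card_edges[OF G(1)] count m by (simp add: class_1_def)
  next
    assume "class_1 G \<and> regular G"
    then show "card (edges G) = chromatic_index G * (order G div 2)"
      using regular_card_edges[OF G(1) _ G(2)] m by (simp add: class_1_def)
  qed
qed

text \<open>
  A matching at odd order \<open>n\<close> has at most \<open>(n - 1) / 2\<close> edges, so the \<open>n * (n - 1) / 2\<close> edges need
  \<open>n\<close> colours.
\<close>

lemma chromatic_index_odd_complete:
  assumes G: "simple_graph G" "edges G = {e. e \<subseteq> verts G \<and> card e = 2}"
    and "odd (order G)" and "edges G \<noteq> {}"
  shows "chromatic_index G = order G" and "card (edges G) = order G * (order G div 2)"
proof -
  obtain m where m: "order G = Suc (2 * m)" using assms(3) by (auto elim: oddE)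
  have "m > 0" using order_ge_2[OF G(1) assms(4)] m by simp
  have "2 * card (edges G) = order G * (2 * m)"
    using twice_card_pairs[of "verts G"] G m by (simp add: simple_graph_def)
  then have count: "card (edges G) = order G * m" by simp
  then show "card (edges G) = order G * (order G div 2)" using m by simp
  have "order G * m \<le> chromatic_index G * m"
    using card_edges_le_if_edge_colorable[OF G(1) edge_colorable_chromatic_index]
      finite_edges[OF G(1)] count m by simp
  then show "chromatic_index G = order G"
    using chromatic_index_le[OF edge_colorable_order[OF G(1)]] \<open>m > 0\<close> by simp
qed

text \<open>
  Let \<open>2 * m + 1\<close> be the order. As the chromatic index exceeds \<open>\<Delta>\<close>, the count gives at least
  \<open>(\<Delta> + 1) * m\<close> edges, while the degrees only allow \<open>(2 * m + 1) * \<Delta> / 2\<close>. Hence \<open>\<Delta> \<ge> 2 * m\<close>, the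
  chromatic index is at least \<open>2 * m + 1\<close>, and the count reaches the number of all pairs of vertices.
\<close>

lemma complete_if_card_edges_eq_and_not_class_1:
  assumes G: "simple_graph G" "verts G \<noteq> {}" and "odd (order G)"
    and count: "card (edges G) = chromatic_index G * (order G div 2)"
    and "\<not> class_1 G"
  shows "edges G = {e. e \<subseteq> verts G \<and> card e = 2}"
proof -
  obtain m where m: "order G = Suc (2 * m)" using assms(3) by (auto elim: oddE)
  have fV: "finite (verts G)" using G by (simp add: simple_graph_def)
  have gt: "Suc (max_degree G) \<le> chromatic_index G"
    using assms(5) max_degree_le_chromatic_index[OF G] by (simp add: class_1_def)
  have "2 * (m * Suc (max_degree G)) \<le> 2 * (m * chromatic_index G)"
    using gt by (intro mult_left_mono) auto
  also have "\<dots> = 2 * card (edges G)" using count m by (simp add: ac_simps)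
  also have "\<dots> \<le> Suc (2 * m) * max_degree G" using twice_card_edges_le[OF G(1)] m by simp
  finally have "2 * m \<le> max_degree G" by simp
  then have "Suc (2 * m) * (2 * m) \<le> chromatic_index G * (2 * m)"
    using gt by (intro mult_right_mono) auto
  then have "card {e. e \<subseteq> verts G \<and> card e = 2} \<le> card (edges G)"
    using twice_card_pairs[OF fV] m count by simp
  moreover have "finite {e. e \<subseteq> verts G \<and> card e = 2}" using fV by simp
  moreover have "edges G \<subseteq> {e. e \<subseteq> verts G \<and> card e = 2}"
    using G(1) by (auto simp: simple_graph_def)
  ultimately show ?thesis by (metis card_seteq)
qed

theorem theorem3p5:
  fixes G :: "'a ugraph" and n :: nat
  assumes "simple_graph G" and "edges G \<noteq> {}" and "order G = n"
  shows "chromatic_edge_stability_index G = n div 2 \<longleftrightarrow>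
      (odd n \<and> isomorphic G (complete_graph n))
    \<or> (class_1 G \<and> regular G \<and> even n)
    \<or> (class_1 G \<and> odd n \<and>
        real (card (edges G)) = (real n - 1) * real (max_degree G) / 2)"
proof -
  have V: "verts G \<noteq> {}" using order_ge_2[OF assms(1,2)] by auto
  have criterion: "chromatic_edge_stability_index G = n div 2
      \<longleftrightarrow> card (edges G) = chromatic_index G * (n div 2)"
    using stability_index_eq_half_order_iff assms by blast
  show ?thesis
  proof (cases "even n")
    case True
    then show ?thesis using criterion card_edges_eq_iff_even[OF assms(1) V] assms(3) by simp
  next
    case False
    then obtain m where m: "n = 2 * m + 1" by (auto elim: oddE)
    have "real (card (edges G)) = (real n - 1) * real (max_degree G) / 2
        \<longleftrightarrow> real (card (edges G)) = real (max_degree G * (n div 2))"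
      using m by (simp add: mult.commute)
    also have "\<dots> \<longleftrightarrow> card (edges G) = max_degree G * (n div 2)" by (rule of_nat_eq_iff)
    finally have third: "real (card (edges G)) = (real n - 1) * real (max_degree G) / 2
        \<longleftrightarrow> card (edges G) = max_degree G * (n div 2)" .
    have complete: "isomorphic G (complete_graph n)
        \<longleftrightarrow> edges G = {e. e \<subseteq> verts G \<and> card e = 2}"
      using isomorphic_complete_graph_iff[OF assms(1)] assms(3) by simp
    have "card (edges G) = chromatic_index G * (n div 2)"
      if "edges G = {e. e \<subseteq> verts G \<and> card e = 2}"
      using chromatic_index_odd_complete[OF assms(1) that] False assms(2,3) by simp
    moreover have "edges G = {e. e \<subseteq> verts G \<and> card e = 2}"
      if "card (edges G) = chromatic_index G * (n div 2)" "\<not> class_1 G"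
      using complete_if_card_edges_eq_and_not_class_1[OF assms(1) V] that False assms(3) by simp
    moreover have "card (edges G) = chromatic_index G * (n div 2)
        \<longleftrightarrow> card (edges G) = max_degree G * (n div 2)" if "class_1 G"
      using that by (simp add: class_1_def)
    ultimately show ?thesis
      using criterion False unfolding third complete by blast
  qed
qed

end
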